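(* A finite connected graph $G$ fulfills the inequality $$\mathrm{QEC}(P_3)\le \mathrm{QEC}(G)<\mathrm{QEC}(P_4)$$ if and only if $G$ is a star product $K_n\star K_2$ with $n\ge2$ or $K_3\star K_3$. Moreover, $$\mathrm{QEC}(K_n\star K_2)=-\frac{2}{2+\sqrt{2\left(1-\frac1n\right)}}\,,\qquad \mathrm{QEC}(K_3\star K_3)=-\frac35\,.$$ In particular, $\mathrm{QEC}(G)=\mathrm{QEC}(P_3)$ if and only if $G=P_3=K_2\star K_2$.
   Context: All graphs are finite, simple and undirected; equality of graphs means isomorphism. $P_n$ is the path on $n$ vertices and $K_n$ the complete graph on $n$ vertices. The star product $K_n\star K_m$ is the graph obtained by joining $K_n$ and $K_m$ at a single vertex: its vertex set is $\{1,2,\dots,n+m-1\}$ and its edge set is $\{\{i,j\}:1\le i<j\le n\}\cup\{\{i,j\}:n\le i<j\le n+m-1\}$. For a connected graph $G=(V,E)$ with $|V|\ge2$, $d(i,j)$ denotes the length of a shortest walk connecting $i$ and $j$ (with $d(i,i)=0$), and $D=[d(i,j)]_{i,j\in V}$ is the distance matrix. $C(V)$ is the space of real-valued functions on $V$, $\langle\cdot,\cdot\rangle$ its canonical inner product, and $\mathbf 1$ the constant function with value $1$. The quadratic embedding constant of $G$ (defined only for connected graphs with at least two vertices, so $G$ is understood to have at least two vertices) is $$\mathrm{QEC}(G)=\max\{\langle f,Df\rangle : f\in C(V),\ \langle f,f\rangle=1,\ \langle \mathbf 1,f\rangle=0\}.$$ *)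

theory Defs
  imports Complex_Main "Graph_Theory.Graph_Theory"
begin

text \<open>
  A finite simple graph is a \<open>pair_graph\<close>: a finite loopfree digraph with a symmetric arc
  relation, each edge \<open>{i, j}\<close> being represented by the two arcs \<open>(i, j)\<close> and \<open>(j, i)\<close>.
  The name \<open>connected\<close> also denotes topological connectedness, so the qualified name
  is used here.
\<close>

definition connected_graph :: "'a pair_pre_digraph \<Rightarrow> bool" where
  "connected_graph G \<longleftrightarrow>
     pair_graph G \<and> Digraph_Component.connected (with_proj G) \<and> 2 \<le> card (pverts G)"

definition graph_iso :: "'a pair_pre_digraph \<Rightarrow> 'b pair_pre_digraph \<Rightarrow> bool" where
  "graph_iso G H \<longleftrightarrow> digraph_iso (with_proj G) (with_proj H)"

definition graph_path :: "nat \<Rightarrow> nat pair_pre_digraph" where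
  "graph_path n = \<lparr> pverts = {1..n},
     parcs = {(i, j). i \<in> {1..n} \<and> j \<in> {1..n} \<and> (j = i + 1 \<or> i = j + 1)} \<rparr>"

text \<open>\<open>star_complete n m\<close> is \<open>K\<^sub>n \<star> K\<^sub>m\<close>, for \<open>n, m \<ge> 1\<close>; the common vertex is \<open>n\<close>.\<close>

definition star_complete :: "nat \<Rightarrow> nat \<Rightarrow> nat pair_pre_digraph" where
  "star_complete n m = \<lparr> pverts = {1..n + m - 1},
     parcs = {(i, j). i \<noteq> j \<and>
       (i \<in> {1..n} \<and> j \<in> {1..n} \<or> i \<in> {n..n + m - 1} \<and> j \<in> {n..n + m - 1})} \<rparr>"

text \<open>Only meaningful if some walk from \<open>i\<close> to \<open>j\<close> exists.\<close>

definition graph_dist :: "'a pair_pre_digraph \<Rightarrow> 'a \<Rightarrow> 'a \<Rightarrow> nat" where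
  "graph_dist G i j = (LEAST k. \<exists>p. pre_digraph.awalk (with_proj G) i p j \<and> length p = k)"

text \<open>
  Functions on the vertex set \<open>V\<close> are represented by functions on the whole type; all
  expressions below only depend on their values on \<open>V\<close>.
\<close>

definition vinner :: "'a set \<Rightarrow> ('a \<Rightarrow> real) \<Rightarrow> ('a \<Rightarrow> real) \<Rightarrow> real" where
  "vinner V f g = (\<Sum>i\<in>V. f i * g i)"

definition dist_matrix_mult :: "'a pair_pre_digraph \<Rightarrow> ('a \<Rightarrow> real) \<Rightarrow> 'a \<Rightarrow> real" where
  "dist_matrix_mult G f = (\<lambda>i. \<Sum>j\<in>pverts G. real (graph_dist G i j) * f j)"

text \<open>
  The maximum of a (possibly infinite) set of reals, hence \<open>GREATEST\<close> rather than
  \<open>Max\<close>.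
\<close>

definition QEC :: "'a pair_pre_digraph \<Rightarrow> real" where
  "QEC G = (GREATEST x. \<exists>f.
     vinner (pverts G) f f = 1 \<and> vinner (pverts G) (\<lambda>_. 1) f = 0 \<and>
     x = vinner (pverts G) f (dist_matrix_mult G f))"

end

theory Submission
  imports Defs "HOL-Analysis.Function_Topology" "HOL-Analysis.Convex"
begin

text \<open>
  The proof has two halves: an exact computation for \<open>K\<^sub>n \<star> K\<^sub>m\<close>, and a reduction of all
  other graphs to it by forbidden induced subgraphs.

  Let \<open>f\<close> sum to zero on \<open>K\<^sub>n \<star> K\<^sub>m\<close> and let \<open>a\<close>, \<open>b\<close> be the sums of \<open>f\<close> over the two cliques
  without the common vertex. All distances are \<open>0\<close>, \<open>1\<close> or \<open>2\<close>, and summing them up gives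
  \<open>\<langle>f, Df\<rangle> = 2ab - \<langle>f, f\<rangle>\<close>. The Cauchy-Schwarz inequality on each side and the inequality of
  the arithmetic and geometric means then yield
  \<open>QEC (K\<^sub>n \<star> K\<^sub>m) = -1 / (1 + sqrt ((1 - 1/n) (1 - 1/m)))\<close> for \<open>n, m \<ge> 2\<close>
  (\<open>clique_star_dist_form\<close>, \<open>QEC_clique_star\<close>). This contains both stated values and, as
  \<open>P\<^sub>3 = K\<^sub>2 \<star> K\<^sub>2\<close>, also \<open>QEC P\<^sub>3 = -2/3\<close>. Since \<open>QEC P\<^sub>4 = sqrt 2 - 2 = -1 / (1 + sqrt (1/2))\<close>, such
  a graph lies below \<open>P\<^sub>4\<close> exactly if \<open>(1 - 1/n) (1 - 1/m) < 1/2\<close>, which means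
  \<open>(n - 2) (m - 2) < 2\<close>: one of \<open>n, m\<close> is \<open>2\<close> or both are \<open>3\<close>. The product is at least \<open>1/4\<close>, with
  equality only for \<open>n = m = 2\<close>.

  Conversely let \<open>G\<close> be connected with \<open>QEC G < QEC P\<^sub>4\<close>. The maximum defining \<open>QEC G\<close> exists by
  compactness, so any function on four vertices that sums to zero gives a lower bound for
  \<open>QEC G\<close> (\<open>four_point_bound\<close>). Suitable functions on an induced claw, diamond (\<open>K\<^sub>4\<close> without an edge),
  4-cycle or 4-path give bounds that are at least \<open>QEC P\<^sub>4\<close>, so \<open>G\<close> contains none of these.
  If \<open>G\<close> is not complete, it has an induced path \<open>a - v - c\<close>; the absence of 4-cycles, 4-paths
  and diamonds makes \<open>v\<close> adjacent to all other vertices, the absence of diamonds makes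
  adjacency transitive on them, and the absence of claws leaves only the two
  classes of \<open>a\<close> and \<open>c\<close>. Hence \<open>G\<close> consists of two cliques sharing \<open>v\<close>
  (\<open>clique_star_if_not_complete\<close>). Complete graphs have \<open>QEC = -1 < QEC P\<^sub>3\<close>.
\<close>

section \<open>Distances\<close>

text \<open>
  Walks of a fixed length are counted by powers of the arc relation, so that small distances can be
  read off from the first few powers.
\<close>

lemma awalk_iff_relpow:
  "(\<exists>p. pre_digraph.awalk (with_proj G) i p j \<and> length p = k) \<longleftrightarrow>
     i \<in> pverts G \<and> (i, j) \<in> parcs G ^^ k" if "pair_wf_digraph G"
proof -
  interpret pair_wf_digraph G by fact
  show ?thesis
  proof (induction k arbitrary: i)
    case 0
    then show ?case by (auto simp: awalk_Nil_iff)
  next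
    case (Suc k)
    have "(\<exists>p. awalk i p j \<and> length p = Suc k) \<longleftrightarrow>
        (\<exists>x. (i, x) \<in> parcs G \<and> (\<exists>p. awalk x p j \<and> length p = k))"
    proof safe
      fix p assume "awalk i p j" "length p = Suc k"
      then show "\<exists>x. (i, x) \<in> parcs G \<and> (\<exists>p. awalk x p j \<and> length p = k)"
        by (cases p) (fastforce simp: awalk_Cons_iff)+
    next
      fix x p assume "(i, x) \<in> parcs G" "awalk x p j" "k = length p"
      then show "\<exists>q. awalk i q j \<and> length q = Suc (length p)"
        by (intro exI[of _ "(i, x) # p"]) (simp add: awalk_Cons_iff)
    qed
    also have "\<dots> \<longleftrightarrow> (\<exists>x. (i, x) \<in> parcs G \<and> (x, j) \<in> parcs G ^^ k)"
      unfolding Suc.IH by (auto dest: in_arcsD2)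
    also have "\<dots> \<longleftrightarrow> i \<in> pverts G \<and> (i, j) \<in> parcs G ^^ Suc k"
      by (auto simp: relpow_commute[symmetric] dest: in_arcsD1)
    finally show ?case .
  qed
qed

lemma graph_dist_relpow:
  assumes "pair_wf_digraph G" "i \<in> pverts G"
  shows "graph_dist G i j = (LEAST k. (i, j) \<in> parcs G ^^ k)"
  using assms by (simp add: graph_dist_def awalk_iff_relpow)

lemma graph_dist_self:
  assumes "pair_wf_digraph G" "i \<in> pverts G"
  shows "graph_dist G i i = 0"
  using assms by (simp add: graph_dist_relpow)

lemma graph_dist_adjacent:
  assumes "pair_wf_digraph G" "(i, j) \<in> parcs G" "i \<noteq> j"
  shows "graph_dist G i j = 1"
proof -
  have "i \<in> pverts G" using assms by (auto dest: pair_wf_digraph.in_arcsD1)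
  moreover have "(LEAST k. (i, j) \<in> parcs G ^^ k) = 1"
  proof (rule Least_equality)
    fix k assume "(i, j) \<in> parcs G ^^ k"
    then show "1 \<le> k" using \<open>i \<noteq> j\<close> by (cases k) auto
  qed (use assms in auto)
  ultimately show ?thesis using assms by (simp add: graph_dist_relpow)
qed

lemma graph_dist_2:
  assumes "pair_wf_digraph G" "(i, x) \<in> parcs G" "(x, j) \<in> parcs G" "(i, j) \<notin> parcs G" "i \<noteq> j"
  shows "graph_dist G i j = 2"
proof -
  have "i \<in> pverts G" using assms by (auto dest: pair_wf_digraph.in_arcsD1)
  moreover have "(LEAST k. (i, j) \<in> parcs G ^^ k) = 2"
  proof (rule Least_equality)
    fix k assume k: "(i, j) \<in> parcs G ^^ k"
    show "2 \<le> k"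
    proof (rule ccontr)
      assume "\<not> 2 \<le> k"
      then have "k = 0 \<or> k = 1" by auto
      then show False using k assms by auto
    qed
  qed (use assms in \<open>auto simp: numeral_2_eq_2\<close>)
  ultimately show ?thesis using assms by (simp add: graph_dist_relpow)
qed

lemma graph_dist_3_le:
  assumes "pair_wf_digraph G" "(i, x) \<in> parcs G" "(x, y) \<in> parcs G" "(y, j) \<in> parcs G"
  shows "graph_dist G i j \<le> 3"
proof -
  have "i \<in> pverts G" using assms by (auto dest: pair_wf_digraph.in_arcsD1)
  moreover have "(i, j) \<in> parcs G ^^ 3" using assms by (auto simp: numeral_3_eq_3)
  ultimately show ?thesis using assms by (simp add: graph_dist_relpow Least_le)
qed

lemma graph_dist_3:
  assumes "pair_wf_digraph G" "(i, x) \<in> parcs G" "(x, y) \<in> parcs G" "(y, j) \<in> parcs G"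
    and "i \<noteq> j" "(i, j) \<notin> parcs G" "\<And>z. (i, z) \<in> parcs G \<Longrightarrow> (z, j) \<notin> parcs G"
  shows "graph_dist G i j = 3"
proof -
  have "i \<in> pverts G" using assms by (auto dest: pair_wf_digraph.in_arcsD1)
  moreover have "(LEAST k. (i, j) \<in> parcs G ^^ k) = 3"
  proof (rule Least_equality)
    fix k assume k: "(i, j) \<in> parcs G ^^ k"
    show "3 \<le> k"
    proof (rule ccontr)
      assume "\<not> 3 \<le> k"
      then have "k = 0 \<or> k = 1 \<or> k = 2" by auto
      then show False using k assms by (auto simp: numeral_2_eq_2)
    qed
  qed (use assms in \<open>auto simp: numeral_3_eq_3\<close>)
  ultimately show ?thesis using assms by (simp add: graph_dist_relpow)
qed

lemma graph_dist_sym: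
  assumes "pair_graph G" "i \<in> pverts G" "j \<in> pverts G"
  shows "graph_dist G i j = graph_dist G j i"
proof -
  interpret pair_graph G by fact
  have *: "(y, x) \<in> parcs G ^^ k" if "(x, y) \<in> parcs G ^^ k" for k x y
    using that
  proof (induction k arbitrary: y)
    case (Suc k)
    then obtain z where "(x, z) \<in> parcs G ^^ k" "(z, y) \<in> parcs G" by auto
    then show ?case using Suc.IH[of z] arcs_symmetric[of z y] by (metis relpow_Suc_I2)
  qed simp
  then have "(i, j) \<in> parcs G ^^ k \<longleftrightarrow> (j, i) \<in> parcs G ^^ k" for k by blast
  then show ?thesis
    using assms by (simp add: graph_dist_relpow[OF pair_wf_digraph])
qed

section \<open>The quadratic form\<close>

definition dist_form :: "'a pair_pre_digraph \<Rightarrow> ('a \<Rightarrow> real) \<Rightarrow> real" where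
  "dist_form G f = (\<Sum>i\<in>pverts G. \<Sum>j\<in>pverts G. real (graph_dist G i j) * f i * f j)"

lemma vinner_dist_matrix_mult: "vinner (pverts G) f (dist_matrix_mult G f) = dist_form G f"
  by (simp add: vinner_def dist_matrix_mult_def dist_form_def sum_distrib_left mult_ac)

lemma vinner_scale: "vinner V (\<lambda>i. c * f i) (\<lambda>i. c * f i) = c\<^sup>2 * vinner V f f"
  by (simp add: vinner_def sum_distrib_left power2_eq_square mult_ac)

lemma dist_form_scale: "dist_form G (\<lambda>i. c * f i) = c\<^sup>2 * dist_form G f"
  by (simp add: dist_form_def sum_distrib_left power2_eq_square mult_ac)

lemma vinner_nonneg: "0 \<le> vinner V f f"
  by (simp add: vinner_def sum_nonneg)

text \<open>
  Both sides of the bound scale with the square of the function, so that neither the maximizer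
  nor the competitors have to be normalized.
\<close>

lemma QEC_eqI:
  assumes sum0: "sum f (pverts G) = 0" and pos: "vinner (pverts G) f f > 0"
    and attained: "dist_form G f = c * vinner (pverts G) f f"
    and bound: "\<And>g. sum g (pverts G) = 0 \<Longrightarrow> dist_form G g \<le> c * vinner (pverts G) g g"
  shows "QEC G = c"
  unfolding QEC_def vinner_dist_matrix_mult
proof (rule Greatest_equality)
  define r where "r = 1 / sqrt (vinner (pverts G) f f)"
  have r: "r\<^sup>2 * vinner (pverts G) f f = 1"
    using pos by (simp add: r_def power_divide)
  have "vinner (pverts G) (\<lambda>_. 1) (\<lambda>i. r * f i) = 0"
    using sum0 by (simp add: vinner_def sum_distrib_left[symmetric])
  moreover have "dist_form G (\<lambda>i. r * f i) = c"
    using r attained by (simp add: dist_form_scale algebra_simps)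
  ultimately show "\<exists>f. vinner (pverts G) f f = 1 \<and> vinner (pverts G) (\<lambda>_. 1) f = 0 \<and> c = dist_form G f"
    using r by (intro exI[of _ "\<lambda>i. r * f i"]) (simp add: vinner_scale)
next
  fix x assume "\<exists>f. vinner (pverts G) f f = 1 \<and> vinner (pverts G) (\<lambda>_. 1) f = 0 \<and> x = dist_form G f"
  then obtain g where "vinner (pverts G) g g = 1" "sum g (pverts G) = 0" "x = dist_form G g"
    by (auto simp: vinner_def)
  then show "x \<le> c" using bound[of g] by simp
qed

text \<open>
  A continuous function on a compact set attains its maximum. Compactness is that of a product of
  intervals in the topology of pointwise convergence, by Tychonoff's theorem.
\<close>

lemma dist_form_max_exists:
  assumes fin: "finite (pverts G)" and card: "2 \<le> card (pverts G)"
  shows "\<exists>f. vinner (pverts G) f f = 1 \<and> sum f (pverts G) = 0 \<and>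
    (\<forall>g. vinner (pverts G) g g = 1 \<longrightarrow> sum g (pverts G) = 0 \<longrightarrow> dist_form G g \<le> dist_form G f)"
proof -
  let ?V = "pverts G"
  define B :: "('a \<Rightarrow> real) set" where "B = PiE UNIV (\<lambda>i. if i \<in> ?V then {-1..1} else {0})"
  define S where "S = B \<inter> ({f. vinner ?V f f = 1} \<inter> {f. sum f ?V = 0})"
  have "compactin (product_topology (\<lambda>_. euclidean) UNIV) B"
    unfolding B_def compactin_PiE by auto
  then have "compact B"
    by (simp add: euclidean_product_topology)
  moreover have "closed {f :: 'a \<Rightarrow> real. vinner ?V f f = 1}" "closed {f :: 'a \<Rightarrow> real. sum f ?V = 0}"
    unfolding vinner_def by (intro closed_Collect_eq continuous_intros; simp)+
  ultimately have "compact S"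
    unfolding S_def by (intro compact_Int_closed closed_Int)
  obtain a b where ab: "a \<in> ?V" "b \<in> ?V" "a \<noteq> b"
    using card by (metis card_le_Suc0_iff_eq fin not_less_eq_eq numeral_2_eq_2)
  define e where "e = (\<lambda>i. if i = a then 1 / sqrt 2 else if i = b then - 1 / sqrt 2 else 0 :: real)"
  have split: "(\<Sum>i\<in>?V. h i) = h a + h b" if "\<And>i. i \<noteq> a \<Longrightarrow> i \<noteq> b \<Longrightarrow> h i = 0" for h :: "'a \<Rightarrow> real"
  proof -
    have "(\<Sum>i\<in>?V. h i) = (\<Sum>i\<in>{a, b}. h i)"
      using that ab fin by (intro sum.mono_neutral_right) auto
    then show ?thesis using ab by simp
  qed
  have "vinner ?V e e = 1" "sum e ?V = 0"
    unfolding vinner_def using ab by (subst split; simp add: e_def)+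
  moreover have "- 1 \<le> 1 / sqrt 2" by (rule order_trans[of _ 0]) auto
  then have "e \<in> B" using ab by (auto simp: B_def e_def)
  ultimately have "S \<noteq> {}" by (auto simp: S_def)
  moreover have "continuous_on S (dist_form G)"
    unfolding dist_form_def[abs_def]
    by (intro continuous_intros continuous_on_subset[OF continuous_on_product_coordinates]) auto
  ultimately obtain f where f: "f \<in> S" "\<And>g. g \<in> S \<Longrightarrow> dist_form G g \<le> dist_form G f"
    using continuous_attains_sup[OF \<open>compact S\<close>] by blast
  have "dist_form G g \<le> dist_form G f" if g: "vinner ?V g g = 1" "sum g ?V = 0" for g
  proof -
    \<comment> \<open>The compact set \<open>B\<close> contains only functions that vanish off the vertex set.\<close>
    define g' where "g' = (\<lambda>i. if i \<in> ?V then g i else 0)"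
    have "\<bar>g i\<bar> \<le> 1" if "i \<in> ?V" for i
    proof -
      have "(g i)\<^sup>2 \<le> vinner ?V g g"
        unfolding vinner_def power2_eq_square[symmetric]
        by (rule member_le_sum) (use that fin in auto)
      then show ?thesis using g by (simp add: abs_square_le_1)
    qed
    then have "g' \<in> B" by (auto simp: B_def g'_def abs_le_iff minus_le_iff)
    moreover have "vinner ?V g' g' = vinner ?V g g" "sum g' ?V = sum g ?V"
      by (simp_all add: vinner_def g'_def)
    ultimately have "g' \<in> S" using g by (simp add: S_def)
    moreover have "dist_form G g' = dist_form G g"
      by (simp add: dist_form_def g'_def)
    ultimately show ?thesis using f(2) by metis
  qed
  then show ?thesis using f(1) by (auto simp: S_def)
qed

lemma QEC_attained:
  assumes "finite (pverts G)" "2 \<le> card (pverts G)"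
  obtains f where "sum f (pverts G) = 0" "vinner (pverts G) f f = 1" "dist_form G f = QEC G"
    "\<And>g. sum g (pverts G) = 0 \<Longrightarrow> dist_form G g \<le> QEC G * vinner (pverts G) g g"
proof -
  obtain f where f: "vinner (pverts G) f f = 1" "sum f (pverts G) = 0"
    and max: "\<And>g. vinner (pverts G) g g = 1 \<Longrightarrow> sum g (pverts G) = 0 \<Longrightarrow> dist_form G g \<le> dist_form G f"
    using dist_form_max_exists[OF assms] by blast
  have bound: "dist_form G g \<le> dist_form G f * vinner (pverts G) g g" if g: "sum g (pverts G) = 0" for g
  proof (cases "vinner (pverts G) g g = 0")
    case True
    then have "\<forall>i\<in>pverts G. g i = 0"
      using assms(1) by (simp add: vinner_def sum_nonneg_eq_0_iff)
    then show ?thesis by (simp add: dist_form_def vinner_def)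
  next
    case False
    then have pos: "vinner (pverts G) g g > 0" using vinner_nonneg[of "pverts G" g] by linarith
    define r where "r = 1 / sqrt (vinner (pverts G) g g)"
    have r: "r\<^sup>2 = 1 / vinner (pverts G) g g"
      using pos by (simp add: r_def power_divide)
    have "dist_form G (\<lambda>i. r * g i) \<le> dist_form G f"
      by (rule max) (use pos g r in \<open>simp_all add: vinner_scale sum_distrib_left[symmetric]\<close>)
    then show ?thesis using pos by (simp add: dist_form_scale r field_simps)
  qed
  moreover have "QEC G = dist_form G f"
    by (rule QEC_eqI[OF f(2)]) (use f bound in auto)
  ultimately show ?thesis using f that by simp
qed

lemma dist_form_le_QEC:
  assumes "finite (pverts G)" "2 \<le> card (pverts G)" "sum g (pverts G) = 0"
  shows "dist_form G g \<le> QEC G * vinner (pverts G) g g"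
  using assms by (metis QEC_attained)

text \<open>
  For a function supported on four vertices the sums reduce to the six distances between them,
  by the symmetry of the distance.
\<close>

lemma dist_form_four:
  assumes G: "pair_graph G" and V: "a \<in> pverts G" "b \<in> pverts G" "c \<in> pverts G" "d \<in> pverts G"
    and dist: "distinct [a, b, c, d]"
    and supp: "\<forall>x\<in>pverts G - {a, b, c, d}. f x = 0"
  shows "sum f (pverts G) = f a + f b + f c + f d"
    and "vinner (pverts G) f f = (f a)\<^sup>2 + (f b)\<^sup>2 + (f c)\<^sup>2 + (f d)\<^sup>2"
    and "dist_form G f = 2 * (f a * f b * graph_dist G a b + f a * f c * graph_dist G a c
      + f a * f d * graph_dist G a d + f b * f c * graph_dist G b c + f b * f d * graph_dist G b d
      + f c * f d * graph_dist G c d)"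
proof -
  interpret pair_graph G by fact
  let ?V = "pverts G"
  have split: "(\<Sum>x\<in>?V. h x) = h a + h b + h c + h d"
    if "\<And>x. f x = 0 \<Longrightarrow> h x = 0" for h :: "'a \<Rightarrow> real"
  proof -
    have "(\<Sum>x\<in>?V. h x) = (\<Sum>x\<in>{a, b, c, d}. h x)"
      using that supp V pair_finite_verts by (intro sum.mono_neutral_right) auto
    then show ?thesis using dist by (simp add: add_ac)
  qed
  show "sum f ?V = f a + f b + f c + f d"
    by (rule split)
  show "vinner ?V f f = (f a)\<^sup>2 + (f b)\<^sup>2 + (f c)\<^sup>2 + (f d)\<^sup>2"
    unfolding vinner_def by (subst split) (simp_all add: power2_eq_square)
  have inner: "(\<Sum>y\<in>?V. real (graph_dist G x y) * f x * f y)
      = f x * (graph_dist G x a * f a + graph_dist G x b * f b + graph_dist G x c * f c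
          + graph_dist G x d * f d)" for x
    by (subst split) (simp_all add: algebra_simps)
  have diag: "graph_dist G a a = 0" "graph_dist G b b = 0" "graph_dist G c c = 0" "graph_dist G d d = 0"
    by (rule graph_dist_self[OF pair_wf_digraph]; fact V)+
  have sym: "graph_dist G b a = graph_dist G a b" "graph_dist G c a = graph_dist G a c"
    "graph_dist G d a = graph_dist G a d" "graph_dist G c b = graph_dist G b c"
    "graph_dist G d b = graph_dist G b d" "graph_dist G d c = graph_dist G c d"
    by (rule graph_dist_sym[OF G]; fact V)+
  have "dist_form G f = f a * (graph_dist G a b * f b + graph_dist G a c * f c + graph_dist G a d * f d)
      + f b * (graph_dist G a b * f a + graph_dist G b c * f c + graph_dist G b d * f d)
      + f c * (graph_dist G a c * f a + graph_dist G b c * f b + graph_dist G c d * f d)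
      + f d * (graph_dist G a d * f a + graph_dist G b d * f b + graph_dist G c d * f c)"
    unfolding dist_form_def inner by (subst split) (simp_all add: diag sym)
  then show "dist_form G f = 2 * (f a * f b * graph_dist G a b + f a * f c * graph_dist G a c
      + f a * f d * graph_dist G a d + f b * f c * graph_dist G b c + f b * f d * graph_dist G b d
      + f c * f d * graph_dist G c d)"
    by (simp add: algebra_simps)
qed

text \<open>
  The distances are those of \<open>G\<close>, not of the induced subgraph, so the bound also covers induced
  subgraphs that are not isometric.
\<close>

lemma four_point_bound:
  fixes \<alpha> \<beta> \<gamma> \<delta> :: real
  assumes G: "pair_graph G" and V: "a \<in> pverts G" "b \<in> pverts G" "c \<in> pverts G" "d \<in> pverts G"
    and dist: "distinct [a, b, c, d]" and sum0: "\<alpha> + \<beta> + \<gamma> + \<delta> = 0"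
  shows "2 * (\<alpha> * \<beta> * graph_dist G a b + \<alpha> * \<gamma> * graph_dist G a c + \<alpha> * \<delta> * graph_dist G a d
      + \<beta> * \<gamma> * graph_dist G b c + \<beta> * \<delta> * graph_dist G b d + \<gamma> * \<delta> * graph_dist G c d)
    \<le> QEC G * (\<alpha>\<^sup>2 + \<beta>\<^sup>2 + \<gamma>\<^sup>2 + \<delta>\<^sup>2)"
proof -
  interpret pair_graph G by fact
  let ?V = "pverts G"
  define f where "f = (\<lambda>x. if x = a then \<alpha> else if x = b then \<beta> else if x = c then \<gamma>
    else if x = d then \<delta> else 0)"
  have f: "f a = \<alpha>" "f b = \<beta>" "f c = \<gamma>" "f d = \<delta>"
    using dist by (auto simp: f_def)
  have "\<forall>x\<in>?V - {a, b, c, d}. f x = 0"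
    by (simp add: f_def)
  note four = dist_form_four[OF G V dist this, unfolded f]
  have "card {a, b, c, d} \<le> card ?V"
    using V pair_finite_verts by (intro card_mono) auto
  then have "2 \<le> card ?V" using dist by simp
  then have "dist_form G f \<le> QEC G * vinner ?V f f"
    using four(1) sum0 by (intro dist_form_le_QEC pair_finite_verts) simp_all
  then show ?thesis unfolding four .
qed

lemma sum_dist_clique:
  assumes "finite Z" "x \<in> Z" "graph_dist G x x = 0" "\<And>y. y \<in> Z \<Longrightarrow> x \<noteq> y \<Longrightarrow> graph_dist G x y = 1"
  shows "(\<Sum>y\<in>Z. real (graph_dist G x y) * f y) = sum f Z - f x"
proof -
  have "(\<Sum>y\<in>Z. real (graph_dist G x y) * f y) = (\<Sum>y\<in>Z - {x}. real (graph_dist G x y) * f y)"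
    using assms by (simp add: sum.remove[of Z x])
  also have "\<dots> = sum f (Z - {x})"
    using assms(4) by (intro sum.cong) auto
  finally show ?thesis using assms by (simp add: sum_diff1)
qed

text \<open>
  On the functions that sum to zero the distance matrix \<open>J - I\<close> acts as \<open>-I\<close>.
\<close>

lemma QEC_complete:
  assumes "pair_wf_digraph G" "finite (pverts G)" "2 \<le> card (pverts G)"
    and complete: "\<And>x y. \<lbrakk>x \<in> pverts G; y \<in> pverts G; x \<noteq> y\<rbrakk> \<Longrightarrow> (x, y) \<in> parcs G"
  shows "QEC G = - 1"
proof -
  obtain f where f: "sum f (pverts G) = 0" "vinner (pverts G) f f = 1" "dist_form G f = QEC G"
    using QEC_attained assms by metis
  have "dist_matrix_mult G f x = - f x" if "x \<in> pverts G" for x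
    using sum_dist_clique[of "pverts G" x G f] that assms f(1)
    by (simp add: dist_matrix_mult_def graph_dist_self graph_dist_adjacent)
  then have "dist_form G f = - vinner (pverts G) f f"
    by (simp add: vinner_dist_matrix_mult[symmetric] vinner_def sum_negf)
  then show ?thesis using f by simp
qed

section \<open>Two cliques sharing a vertex\<close>

text \<open>
  The shape of a star product of complete graphs, inside an arbitrary vertex type: \<open>insert v X\<close> and
  \<open>insert v Y\<close> are the two cliques. It is invariant under isomorphism, which
  spares a comparison of distances in isomorphic graphs.
\<close>

definition clique_star :: "'a pair_pre_digraph \<Rightarrow> 'a \<Rightarrow> 'a set \<Rightarrow> 'a set \<Rightarrow> bool" where
  "clique_star G v X Y \<longleftrightarrow> v \<notin> X \<union> Y \<and> X \<inter> Y = {} \<and> pverts G = insert v (X \<union> Y) \<and>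
     parcs G = {(x, y). x \<noteq> y \<and> ({x, y} \<subseteq> insert v X \<or> {x, y} \<subseteq> insert v Y)}"

lemma clique_star_swap: "clique_star G v X Y \<longleftrightarrow> clique_star G v Y X"
  by (auto simp: clique_star_def)

lemma clique_star_dist:
  assumes "clique_star G v X Y"
  shows "x \<in> pverts G \<Longrightarrow> graph_dist G x x = 0"
    and "\<lbrakk>x \<in> insert v X; y \<in> insert v X; x \<noteq> y\<rbrakk> \<Longrightarrow> graph_dist G x y = 1"
    and "\<lbrakk>x \<in> insert v Y; y \<in> insert v Y; x \<noteq> y\<rbrakk> \<Longrightarrow> graph_dist G x y = 1"
    and "\<lbrakk>x \<in> X; y \<in> Y\<rbrakk> \<Longrightarrow> graph_dist G x y = 2"
    and "\<lbrakk>x \<in> Y; y \<in> X\<rbrakk> \<Longrightarrow> graph_dist G x y = 2"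
proof -
  have wf: "pair_wf_digraph G"
    using assms by unfold_locales (auto simp: clique_star_def)
  note graph = assms[unfolded clique_star_def]
  show "x \<in> pverts G \<Longrightarrow> graph_dist G x x = 0"
    using wf by (rule graph_dist_self)
  show "\<lbrakk>x \<in> insert v X; y \<in> insert v X; x \<noteq> y\<rbrakk> \<Longrightarrow> graph_dist G x y = 1"
    by (rule graph_dist_adjacent[OF wf]) (use graph in auto)
  show "\<lbrakk>x \<in> insert v Y; y \<in> insert v Y; x \<noteq> y\<rbrakk> \<Longrightarrow> graph_dist G x y = 1"
    by (rule graph_dist_adjacent[OF wf]) (use graph in auto)
  show "\<lbrakk>x \<in> X; y \<in> Y\<rbrakk> \<Longrightarrow> graph_dist G x y = 2"
    by (rule graph_dist_2[OF wf, of _ v]) (use graph in auto)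
  show "\<lbrakk>x \<in> Y; y \<in> X\<rbrakk> \<Longrightarrow> graph_dist G x y = 2"
    by (rule graph_dist_2[OF wf, of _ v]) (use graph in auto)
qed

lemma clique_star_sum:
  fixes h :: "'a \<Rightarrow> real"
  assumes "clique_star G v X Y" "finite X" "finite Y"
  shows "sum h (pverts G) = h v + sum h X + sum h Y"
  using assms by (simp add: clique_star_def sum.union_disjoint)

text \<open>
  If \<open>a\<close> and \<open>b\<close> are the sums of \<open>f\<close> over \<open>X\<close> and \<open>Y\<close>, then \<open>f v = - a - b\<close>, and \<open>Df\<close> takes the
  values \<open>- f v\<close> at \<open>v\<close>, \<open>b - f x\<close> at \<open>x \<in> X\<close> and \<open>a - f y\<close> at \<open>y \<in> Y\<close>.
\<close>

lemma clique_star_dist_form: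
  fixes f :: "'a \<Rightarrow> real"
  assumes star: "clique_star G v X Y" and fin: "finite X" "finite Y"
    and sum0: "sum f (pverts G) = 0"
  shows "dist_form G f = 2 * sum f X * sum f Y - vinner (pverts G) f f"
proof -
  note dist = clique_star_dist[OF star]
  note graph = star[unfolded clique_star_def]
  let ?D = "dist_matrix_mult G f"
  have v: "f v = - (sum f X + sum f Y)"
    using sum0 by (simp add: clique_star_sum[OF star fin])
  have Dv: "?D v = - f v"
  proof -
    have "graph_dist G v y = 1" if "y \<in> X \<union> Y" for y
      using that graph dist(2)[of v y] dist(3)[of v y] by auto
    then show ?thesis
      using dist(1)[of v] graph v unfolding dist_matrix_mult_def clique_star_sum[OF star fin] by simp
  qed
  have DX: "?D x = sum f Y - f x" if "x \<in> X" for x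
  proof -
    have "(\<Sum>y\<in>X. real (graph_dist G x y) * f y) = sum f X - f x"
      using that fin graph dist(1) dist(2) by (intro sum_dist_clique) auto
    moreover have "(\<Sum>y\<in>Y. real (graph_dist G x y) * f y) = 2 * sum f Y"
      using that dist(4) by (simp add: sum_distrib_left)
    moreover have "graph_dist G x v = 1" using that graph dist(2)[of x v] by auto
    ultimately show ?thesis
      using v by (simp add: dist_matrix_mult_def clique_star_sum[OF star fin])
  qed
  have DY: "?D y = sum f X - f y" if "y \<in> Y" for y
  proof -
    have "(\<Sum>x\<in>Y. real (graph_dist G y x) * f x) = sum f Y - f y"
      using that fin graph dist(1) dist(3) by (intro sum_dist_clique) auto
    moreover have "(\<Sum>x\<in>X. real (graph_dist G y x) * f x) = 2 * sum f X"
      using that dist(5) by (simp add: sum_distrib_left)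
    moreover have "graph_dist G y v = 1" using that graph dist(3)[of y v] by auto
    ultimately show ?thesis
      using v by (simp add: dist_matrix_mult_def clique_star_sum[OF star fin])
  qed
  have "dist_form G f = f v * ?D v + (\<Sum>x\<in>X. f x * ?D x) + (\<Sum>y\<in>Y. f y * ?D y)"
    by (simp only: vinner_dist_matrix_mult[symmetric] vinner_def clique_star_sum[OF star fin])
  also have "\<dots> = - (f v * f v) + (\<Sum>x\<in>X. f x * sum f Y - f x * f x) + (\<Sum>y\<in>Y. f y * sum f X - f y * f y)"
    by (simp add: Dv DX DY right_diff_distrib)
  also have "\<dots> = 2 * sum f X * sum f Y - vinner (pverts G) f f"
    by (simp add: sum_subtractf sum_distrib_right[symmetric] vinner_def clique_star_sum[OF star fin])
  finally show ?thesis .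
qed

text \<open>
  The Cauchy-Schwarz inequality \<open>a\<^sup>2 \<le> p A\<close> for the sum \<open>a\<close> and the square sum \<open>A\<close> of \<open>p\<close> numbers, with
  \<open>p a\<^sup>2\<close> added on both sides.
\<close>

lemma sum_square_le:
  fixes f :: "'a \<Rightarrow> real"
  assumes "finite X"
  shows "(sum f X)\<^sup>2 \<le> real (card X) / (real (card X) + 1) * ((sum f X)\<^sup>2 + (\<Sum>x\<in>X. f x * f x))"
proof -
  have "(sum f X)\<^sup>2 \<le> real (card X) * (\<Sum>x\<in>X. f x * f x)"
    using Cauchy_Schwarz_ineq_sum[of "\<lambda>_. 1" f X] by (simp add: power2_eq_square)
  then show ?thesis by (simp add: field_simps)
qed

text \<open>
  Let \<open>s = a\<^sup>2 + A\<close> and \<open>t = b\<^sup>2 + B\<close>, where \<open>a\<close>, \<open>b\<close> are the sums and \<open>A\<close>, \<open>B\<close> the square sums of \<open>f\<close> over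
  \<open>X\<close> and \<open>Y\<close>. Then \<open>\<langle>f, f\<rangle> = 2ab + s + t\<close> and \<open>\<langle>f, Df\<rangle> = - (s + t)\<close>, so that the ratio of the two is
  largest when \<open>2ab / (s + t)\<close> is. From \<open>a\<^sup>2 \<le> \<alpha> s\<close>, \<open>b\<^sup>2 \<le> \<beta> t\<close> and \<open>2 sqrt (s t) \<le> s + t\<close> the maximum of this
  quotient is at most \<open>c = sqrt (\<alpha> \<beta>)\<close>.
\<close>

lemma QEC_clique_star:
  assumes star: "clique_star G v X Y" and fin: "finite X" "finite Y" and ne: "X \<noteq> {}" "Y \<noteq> {}"
  shows "QEC G = - 1 / (1 + sqrt (real (card X) / (real (card X) + 1) * (real (card Y) / (real (card Y) + 1))))"
proof -
  let ?V = "pverts G"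
  define p q where pq: "p = real (card X)" "q = real (card Y)"
  have pos: "0 < p" "0 < q" using fin ne by (simp_all add: pq card_gt_0_iff)
  define \<alpha> \<beta> where ab: "\<alpha> = p / (p + 1)" "\<beta> = q / (q + 1)"
  have ab_pos: "0 < \<alpha>" "0 < \<beta>" using pos by (simp_all add: ab)
  define c where "c = sqrt (\<alpha> * \<beta>)"
  have c: "0 < c" "c\<^sup>2 = \<alpha> * \<beta>" using ab_pos by (simp_all add: c_def)
  note v_notin = star[unfolded clique_star_def]
  have norm: "vinner ?V g g = 2 * sum g X * sum g Y
      + ((sum g X)\<^sup>2 + (\<Sum>x\<in>X. g x * g x)) + ((sum g Y)\<^sup>2 + (\<Sum>y\<in>Y. g y * g y))"
    if "sum g ?V = 0" for g :: "'a \<Rightarrow> real"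
  proof -
    have "g v = - (sum g X + sum g Y)"
      using that by (simp add: clique_star_sum[OF star fin])
    then have "g v * g v = (sum g X + sum g Y)\<^sup>2"
      by (simp only: power2_eq_square minus_mult_minus)
    then show ?thesis
      by (simp add: vinner_def clique_star_sum[OF star fin] power2_eq_square algebra_simps)
  qed
  have bound: "dist_form G g \<le> (- 1 / (1 + c)) * vinner ?V g g" if g: "sum g ?V = 0" for g :: "'a \<Rightarrow> real"
  proof -
    let ?a = "sum g X" and ?b = "sum g Y"
    define s t where st: "s = ?a\<^sup>2 + (\<Sum>x\<in>X. g x * g x)" "t = ?b\<^sup>2 + (\<Sum>y\<in>Y. g y * g y)"
    have "0 \<le> s" "0 \<le> t" unfolding st by (simp_all add: sum_nonneg)
    have sq: "?a\<^sup>2 \<le> \<alpha> * s" "?b\<^sup>2 \<le> \<beta> * t"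
      using sum_square_le[OF fin(1), of g] sum_square_le[OF fin(2), of g] by (simp_all add: st ab pq)
    have "(2 * ?a * ?b)\<^sup>2 = 4 * (?a\<^sup>2 * ?b\<^sup>2)" by (simp add: power_mult_distrib)
    also have "\<dots> \<le> 4 * ((\<alpha> * s) * (\<beta> * t))"
      using sq ab_pos \<open>0 \<le> s\<close> by (intro mult_left_mono mult_mono) auto
    also have "\<dots> = c\<^sup>2 * (4 * s * t)" by (simp add: c)
    also have "\<dots> \<le> c\<^sup>2 * (s + t)\<^sup>2"
      using sum_squares_bound[of s t] by (intro mult_left_mono) (simp_all add: power2_sum)
    also have "\<dots> = (c * (s + t))\<^sup>2" by (simp add: power_mult_distrib)
    finally have "2 * ?a * ?b \<le> c * (s + t)"
      by (rule power2_le_imp_le) (use c(1) \<open>0 \<le> s\<close> \<open>0 \<le> t\<close> in simp)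
    moreover have N: "vinner ?V g g = 2 * ?a * ?b + (s + t)" using norm[OF g] by (simp add: st)
    ultimately have "vinner ?V g g / (1 + c) \<le> s + t"
      using c(1) by (simp add: pos_divide_le_eq algebra_simps)
    moreover have "dist_form G g = - (s + t)"
      unfolding clique_star_dist_form[OF star fin g] N by simp
    ultimately show ?thesis by simp
  qed
  \<comment> \<open>Equality needs \<open>f\<close> constant on \<open>X\<close> and on \<open>Y\<close>, and \<open>s = t\<close>; the constants normalize \<open>s\<close> and \<open>t\<close> to 1.\<close>
  define f where "f = (\<lambda>x. if x = v then - (sqrt \<alpha> + sqrt \<beta>) else if x \<in> X then sqrt \<alpha> / p else sqrt \<beta> / q)"
  have "(\<Sum>x\<in>X. h (f x)) = p * h (sqrt \<alpha> / p)" for h :: "real \<Rightarrow> real"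
  proof -
    have "(\<Sum>x\<in>X. h (f x)) = (\<Sum>x\<in>X. h (sqrt \<alpha> / p))"
      using v_notin by (intro sum.cong) (auto simp: f_def)
    then show ?thesis by (simp add: pq)
  qed
  note fX = this[of "\<lambda>x. x"] this[of "\<lambda>x. x * x"]
  have "(\<Sum>x\<in>Y. h (f x)) = q * h (sqrt \<beta> / q)" for h :: "real \<Rightarrow> real"
  proof -
    have "(\<Sum>x\<in>Y. h (f x)) = (\<Sum>x\<in>Y. h (sqrt \<beta> / q))"
      using v_notin by (intro sum.cong) (auto simp: f_def)
    then show ?thesis by (simp add: pq)
  qed
  note fY = this[of "\<lambda>x. x"] this[of "\<lambda>x. x * x"]
  have sums: "sum f X = sqrt \<alpha>" "sum f Y = sqrt \<beta>"
    using fX(1) fY(1) pos by simp_all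
  have f0: "sum f ?V = 0"
    by (simp add: clique_star_sum[OF star fin] sums) (simp add: f_def)
  have "(sum f X)\<^sup>2 + (\<Sum>x\<in>X. f x * f x) = \<alpha> + \<alpha> / p" "(sum f Y)\<^sup>2 + (\<Sum>y\<in>Y. f y * f y) = \<beta> + \<beta> / q"
    unfolding sums fX(2) fY(2) using pos ab_pos by simp_all
  moreover have "\<alpha> + \<alpha> / p = 1" "\<beta> + \<beta> / q = 1"
    using pos by (simp_all add: ab add_divide_distrib[symmetric])
  moreover have prod: "sum f X * sum f Y = c" by (simp add: sums c_def real_sqrt_mult)
  ultimately have "vinner ?V f f = 2 * c + 2" using norm[OF f0] by simp
  moreover have "dist_form G f = - 2"
    using clique_star_dist_form[OF star fin f0] prod calculation by simp
  ultimately have "QEC G = - 1 / (1 + c)"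
    using c(1) by (intro QEC_eqI[OF f0 _ _ bound]) (auto simp: field_simps)
  then show ?thesis by (simp add: c_def ab pq)
qed

section \<open>Isomorphism\<close>

text \<open>
  An isomorphism of digraphs carries its own maps on arcs, heads and tails. For graphs
  whose arcs are pairs of vertices these are determined by the vertex bijection.
\<close>

lemma graph_iso_iff_bij:
  assumes "pair_wf_digraph G" "pair_wf_digraph H"
  shows "graph_iso G H \<longleftrightarrow> (\<exists>\<phi>. bij_betw \<phi> (pverts G) (pverts H) \<and>
    (\<forall>x\<in>pverts G. \<forall>y\<in>pverts G. (x, y) \<in> parcs G \<longleftrightarrow> (\<phi> x, \<phi> y) \<in> parcs H))"
    (is "_ \<longleftrightarrow> (\<exists>\<phi>. ?iso \<phi>)")
proof
  interpret G: pair_wf_digraph G by fact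
  assume "graph_iso G H"
  then obtain f where f: "pre_digraph.digraph_isomorphism (with_proj G) f"
    "with_proj H = app_iso f (with_proj G)"
    unfolding graph_iso_def digraph_iso_def by blast
  let ?\<phi> = "iso_verts f"
  have V: "pverts H = ?\<phi> ` pverts G" and A: "parcs H = iso_arcs f ` parcs G"
    and ends: "iso_tail f = fst" "iso_head f = snd"
    using arg_cong[OF f(2), of verts] arg_cong[OF f(2), of arcs]
      arg_cong[OF f(2), of tail] arg_cong[OF f(2), of head] by simp_all
  have inj: "inj_on ?\<phi> (pverts G)"
    using f(1) by (simp add: pre_digraph.digraph_isomorphism_def)
  have arc: "iso_arcs f a = (?\<phi> (fst a), ?\<phi> (snd a))" if "a \<in> parcs G" for a
    using f(1) that by (simp add: pre_digraph.digraph_isomorphism_def ends prod_eq_iff)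
  have "(x, y) \<in> parcs G \<longleftrightarrow> (?\<phi> x, ?\<phi> y) \<in> parcs H" if xy: "x \<in> pverts G" "y \<in> pverts G" for x y
  proof
    assume "(x, y) \<in> parcs G"
    then show "(?\<phi> x, ?\<phi> y) \<in> parcs H" unfolding A using arc[of "(x, y)"] by force
  next
    assume "(?\<phi> x, ?\<phi> y) \<in> parcs H"
    then obtain a where a: "a \<in> parcs G" "(?\<phi> x, ?\<phi> y) = (?\<phi> (fst a), ?\<phi> (snd a))"
      unfolding A using arc by auto
    then have "fst a = x" "snd a = y"
      using inj xy G.arc_fst_in_verts[OF a(1)] G.arc_snd_in_verts[OF a(1)] by (auto dest: inj_onD)
    then show "(x, y) \<in> parcs G" using a(1) by (metis prod.collapse)
  qed
  then have "?iso ?\<phi>" using inj V by (simp add: bij_betw_def)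
  then show "\<exists>\<phi>. ?iso \<phi>" by (rule exI[where x = ?\<phi>])
next
  interpret G: pair_wf_digraph G by fact
  interpret H: pair_wf_digraph H by fact
  assume "\<exists>\<phi>. ?iso \<phi>"
  then obtain \<phi> where bij: "bij_betw \<phi> (pverts G) (pverts H)"
    and arcs: "\<And>x y. \<lbrakk>x \<in> pverts G; y \<in> pverts G\<rbrakk> \<Longrightarrow> (x, y) \<in> parcs G \<longleftrightarrow> (\<phi> x, \<phi> y) \<in> parcs H"
    by blast
  define f where "f = \<lparr>iso_verts = \<phi>, iso_arcs = map_prod \<phi> \<phi>, iso_head = snd, iso_tail = fst\<rparr>"
  have inj: "inj_on \<phi> (pverts G)" and V: "pverts H = \<phi> ` pverts G"
    using bij by (auto simp: bij_betw_def)
  have "parcs G \<subseteq> pverts G \<times> pverts G" using G.in_arcsD1 G.in_arcsD2 by auto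
  then have inj_arcs: "inj_on (map_prod \<phi> \<phi>) (parcs G)"
    using map_prod_inj_on[OF inj inj] inj_on_subset by blast
  have "parcs H = map_prod \<phi> \<phi> ` parcs G"
  proof (intro equalityI subsetI)
    fix a assume a: "a \<in> parcs H"
    then obtain x y where xy: "a = (\<phi> x, \<phi> y)" "x \<in> pverts G" "y \<in> pverts G"
      using H.arc_fst_in_verts[OF a] H.arc_snd_in_verts[OF a] unfolding V by (cases a) auto
    then show "a \<in> map_prod \<phi> \<phi> ` parcs G"
      using a arcs by (metis image_eqI map_prod_simp)
  next
    fix a assume "a \<in> map_prod \<phi> \<phi> ` parcs G"
    then obtain x y where "(x, y) \<in> parcs G" "a = (\<phi> x, \<phi> y)" by auto
    then show "a \<in> parcs H"
      using arcs[OF G.in_arcsD1 G.in_arcsD2] by blast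
  qed
  then have "with_proj H = app_iso f (with_proj G)"
    by (simp add: app_iso_def f_def V with_proj_def)
  moreover have "pre_digraph.digraph_isomorphism (with_proj G) f"
    using inj inj_arcs G.wf_digraph_axioms by (simp add: pre_digraph.digraph_isomorphism_def f_def)
  ultimately show "graph_iso G H"
    unfolding graph_iso_def digraph_iso_def by blast
qed

lemma clique_star_image:
  assumes star: "clique_star G v X Y" and H: "pair_wf_digraph H"
    and bij: "bij_betw \<phi> (pverts G) (pverts H)"
    and arcs: "\<And>x y. \<lbrakk>x \<in> pverts G; y \<in> pverts G\<rbrakk> \<Longrightarrow> (x, y) \<in> parcs G \<longleftrightarrow> (\<phi> x, \<phi> y) \<in> parcs H"
  shows "clique_star H (\<phi> v) (\<phi> ` X) (\<phi> ` Y)"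
proof -
  interpret H: pair_wf_digraph H by fact
  note graph = star[unfolded clique_star_def]
  let ?V = "pverts G"
  have inj: "inj_on \<phi> ?V" and V: "pverts H = \<phi> ` ?V" using bij by (auto simp: bij_betw_def)
  have mem: "\<phi> x \<in> \<phi> ` Z \<longleftrightarrow> x \<in> Z" if "x \<in> ?V" "Z \<subseteq> ?V" for x Z
    using inj that by (rule inj_on_image_mem_iff)
  have sub: "v \<in> ?V" "X \<subseteq> ?V" "Y \<subseteq> ?V" using graph by auto
  have "\<phi> v \<notin> \<phi> ` X \<union> \<phi> ` Y" using mem sub graph by blast
  moreover have "\<phi> ` X \<inter> \<phi> ` Y = {}"
    using inj_on_image_Int[OF inj sub(2,3)] graph by simp
  moreover have "pverts H = insert (\<phi> v) (\<phi> ` X \<union> \<phi> ` Y)" using graph V by auto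
  moreover have "(a, b) \<in> parcs H \<longleftrightarrow> a \<noteq> b \<and>
      ({a, b} \<subseteq> insert (\<phi> v) (\<phi> ` X) \<or> {a, b} \<subseteq> insert (\<phi> v) (\<phi> ` Y))" for a b
  proof (cases "a \<in> pverts H \<and> b \<in> pverts H")
    case True
    then obtain x y where xy: "a = \<phi> x" "b = \<phi> y" "x \<in> ?V" "y \<in> ?V" unfolding V by auto
    have "\<phi> z \<in> insert (\<phi> v) (\<phi> ` Z) \<longleftrightarrow> z \<in> insert v Z" if "z \<in> ?V" "Z \<subseteq> ?V" for z Z
      using mem[of z "insert v Z"] that sub(1) by simp
    moreover have "\<phi> x = \<phi> y \<longleftrightarrow> x = y" using inj xy by (auto dest: inj_onD)
    moreover have "(x, y) \<in> parcs G \<longleftrightarrow> x \<noteq> y \<and> ({x, y} \<subseteq> insert v X \<or> {x, y} \<subseteq> insert v Y)"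
      using graph by auto
    ultimately show ?thesis using arcs xy sub by (simp only: insert_subset) simp
  next
    case False
    then show ?thesis using H.in_arcsD1 H.in_arcsD2 V sub by auto
  qed
  ultimately show ?thesis unfolding clique_star_def by auto
qed

lemma clique_star_wf: "clique_star G v X Y \<Longrightarrow> pair_wf_digraph G"
  by unfold_locales (auto simp: clique_star_def)

lemma clique_star_iso:
  assumes G: "clique_star G v X Y" and H: "clique_star H w X' Y'"
    and fin: "finite X" "finite Y" "finite X'" "finite Y'"
    and card: "card X = card X'" "card Y = card Y'"
  shows "graph_iso G H"
proof -
  note graph = G[unfolded clique_star_def] H[unfolded clique_star_def]
  obtain g h where g: "bij_betw g X X'" and h: "bij_betw h Y Y'"
    using fin card finite_same_card_bij by metis
  define \<phi> where "\<phi> = (\<lambda>x. if x = v then w else if x \<in> X then g x else h x)"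
  have \<phi>X: "bij_betw \<phi> X X'" using graph by (intro bij_betw_cong[THEN iffD1, OF _ g]) (auto simp: \<phi>_def)
  have \<phi>Y: "bij_betw \<phi> Y Y'" using graph by (intro bij_betw_cong[THEN iffD1, OF _ h]) (auto simp: \<phi>_def)
  have \<phi>v: "\<phi> v = w" by (simp add: \<phi>_def)
  have "bij_betw \<phi> ({v} \<union> (X \<union> Y)) ({w} \<union> (X' \<union> Y'))"
    using \<phi>X \<phi>Y \<phi>v graph by (intro bij_betw_combine) auto
  then have bij: "bij_betw \<phi> (pverts G) (pverts H)" using graph by simp
  have inj: "inj_on \<phi> (pverts G)" using bij by (rule bij_betw_imp_inj_on)
  have memX: "\<phi> x \<in> insert w X' \<longleftrightarrow> x \<in> insert v X" if "x \<in> pverts G" for x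
    using inj_on_image_mem_iff[OF inj that, of "insert v X"] graph \<phi>v bij_betw_imp_surj_on[OF \<phi>X] by auto
  have memY: "\<phi> x \<in> insert w Y' \<longleftrightarrow> x \<in> insert v Y" if "x \<in> pverts G" for x
    using inj_on_image_mem_iff[OF inj that, of "insert v Y"] graph \<phi>v bij_betw_imp_surj_on[OF \<phi>Y] by auto
  have "(x, y) \<in> parcs G \<longleftrightarrow> (\<phi> x, \<phi> y) \<in> parcs H" if "x \<in> pverts G" "y \<in> pverts G" for x y
  proof -
    have "(x, y) \<in> parcs G \<longleftrightarrow> x \<noteq> y \<and> ({x, y} \<subseteq> insert v X \<or> {x, y} \<subseteq> insert v Y)"
      using graph by auto
    moreover have "(\<phi> x, \<phi> y) \<in> parcs H \<longleftrightarrow>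
        \<phi> x \<noteq> \<phi> y \<and> ({\<phi> x, \<phi> y} \<subseteq> insert w X' \<or> {\<phi> x, \<phi> y} \<subseteq> insert w Y')"
      using graph by auto
    moreover have "\<phi> x = \<phi> y \<longleftrightarrow> x = y" using inj that by (auto dest: inj_onD)
    ultimately show ?thesis using memX memY that by (simp only: insert_subset) simp
  qed
  then show ?thesis
    using bij graph_iso_iff_bij[OF clique_star_wf[OF G] clique_star_wf[OF H]] by blast
qed

lemma clique_star_star_complete:
  "clique_star (star_complete (Suc p) (Suc q)) (Suc p) {1..p} {p + 2..p + q + 1}"
  by (auto simp: clique_star_def star_complete_def)

lemma graph_iso_star_complete_iff:
  assumes "pair_graph G"
  shows "graph_iso G (star_complete (Suc p) (Suc q)) \<longleftrightarrow>
    (\<exists>v X Y. clique_star G v X Y \<and> card X = p \<and> card Y = q)"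
proof
  interpret pair_graph G by fact
  let ?S = "star_complete (Suc p) (Suc q)"
  note S = clique_star_star_complete[of p q]
  assume "graph_iso G ?S"
  then obtain \<phi> where bij: "bij_betw \<phi> (pverts G) (pverts ?S)"
    and arcs: "\<And>x y. \<lbrakk>x \<in> pverts G; y \<in> pverts G\<rbrakk> \<Longrightarrow> (x, y) \<in> parcs G \<longleftrightarrow> (\<phi> x, \<phi> y) \<in> parcs ?S"
    using graph_iso_iff_bij[OF pair_wf_digraph clique_star_wf[OF S]] by blast
  let ?\<psi> = "the_inv_into (pverts G) \<phi>"
  have bij': "bij_betw ?\<psi> (pverts ?S) (pverts G)" using bij by (rule bij_betw_the_inv_into)
  have "clique_star G (?\<psi> (Suc p)) (?\<psi> ` {1..p}) (?\<psi> ` {p + 2..p + q + 1})"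
  proof (rule clique_star_image[OF S pair_wf_digraph bij'])
    fix x y assume xy: "x \<in> pverts ?S" "y \<in> pverts ?S"
    then have "?\<psi> x \<in> pverts G" "?\<psi> y \<in> pverts G" using bij' by (auto simp: bij_betw_def)
    moreover have "\<phi> (?\<psi> x) = x" "\<phi> (?\<psi> y) = y"
      using xy f_the_inv_into_f_bij_betw[OF bij] by auto
    ultimately show "(x, y) \<in> parcs ?S \<longleftrightarrow> (?\<psi> x, ?\<psi> y) \<in> parcs G" using arcs by simp
  qed
  moreover have "card (?\<psi> ` Z) = card Z" if "Z \<subseteq> pverts ?S" for Z
    using that bij' by (intro card_image) (auto simp: bij_betw_def intro: inj_on_subset)
  moreover have "{1..p} \<subseteq> pverts ?S" "{p + 2..p + q + 1} \<subseteq> pverts ?S"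
    using S by (auto simp: clique_star_def)
  moreover have "card {1..p} = p" "card {p + 2..p + q + 1} = q" by simp_all
  ultimately show "\<exists>v X Y. clique_star G v X Y \<and> card X = p \<and> card Y = q"
    by metis
next
  interpret pair_graph G by fact
  assume "\<exists>v X Y. clique_star G v X Y \<and> card X = p \<and> card Y = q"
  then obtain v X Y where star: "clique_star G v X Y" and card: "card X = p" "card Y = q" by blast
  then have "finite X" "finite Y"
    using pair_finite_verts by (auto simp: clique_star_def)
  then show "graph_iso G (star_complete (Suc p) (Suc q))"
    using card by (intro clique_star_iso[OF star clique_star_star_complete]) auto
qed

lemma graph_path_3: "graph_path 3 = star_complete 2 2"
  by (auto simp: graph_path_def star_complete_def)

section \<open>The path on four vertices\<close>

lemma pair_graph_path: "pair_graph (graph_path n)"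
proof -
  have "finite (parcs (graph_path n))"
    by (rule finite_subset[of _ "{1..n} \<times> {1..n}"]) (auto simp: graph_path_def)
  then show ?thesis
    by unfold_locales (auto simp: graph_path_def symmetric_def sym_def)
qed

text \<open>
  The upper bound is a sum of squares. With the partial sums \<open>a = g 1\<close>, \<open>b = g 1 + g 2\<close> and \<open>c = - g 4\<close> of a
  function summing to zero, each edge of the path separates the vertices into two parts and
  \<open>\<langle>g, Dg\<rangle> = - 2 (a\<^sup>2 + b\<^sup>2 + c\<^sup>2)\<close>. Equality holds for \<open>a = c\<close> and \<open>b = - sqrt 2 a\<close>, which gives the
  antisymmetric function \<open>f\<close> below.
\<close>

lemma QEC_path_4: "QEC (graph_path 4) = sqrt 2 - 2"
proof -
  let ?P = "graph_path 4"
  have P: "pair_graph ?P" by (rule pair_graph_path)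
  have wf: "pair_wf_digraph ?P"
    using P by (simp add: pair_graph_def pair_digraph_def pair_fin_digraph_def)
  have V: "pverts ?P = {1, 2, 3, 4}" by (auto simp: graph_path_def)
  have E: "(i, j) \<in> parcs ?P \<longleftrightarrow> i \<in> {1..4} \<and> j \<in> {1..4} \<and> (j = i + 1 \<or> i = j + 1)" for i j
    by (simp add: graph_path_def)
  have d1: "graph_dist ?P 1 2 = 1" "graph_dist ?P 2 3 = 1" "graph_dist ?P 3 4 = 1"
    by (rule graph_dist_adjacent[OF wf]; simp add: E)+
  have d2: "graph_dist ?P 1 3 = 2" "graph_dist ?P 2 4 = 2"
    using graph_dist_2[OF wf, of 1 2 3] graph_dist_2[OF wf, of 2 3 4] by (simp_all add: E)
  have d3: "graph_dist ?P 1 4 = 3"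
    by (rule graph_dist_3[OF wf, of _ 2 3]) (auto simp: E)
  note four = dist_form_four[OF P, of 1 2 3 4, unfolded d1 d2 d3 V, simplified]
  define s :: real where "s = sqrt 2"
  have s: "s * s = 2" "1 < s" by (simp_all add: s_def)
  have ss: "s * (s * x) = 2 * x" for x using s(1) by (simp add: mult.assoc[symmetric])
  define f :: "nat \<Rightarrow> real" where
    "f = (\<lambda>i. if i = 1 then 1 else if i = 2 then - (1 + s) else if i = 3 then 1 + s else - 1)"
  have f: "f (Suc 0) = 1" "f 2 = - (1 + s)" "f 3 = 1 + s" "f 4 = - 1" by (simp_all add: f_def)
  have sum: "sum f (pverts ?P) = 0" by (simp add: V f)
  have N: "vinner (pverts ?P) f f = 2 + 2 * (1 + s)\<^sup>2"
    by (simp add: V vinner_def f power2_eq_square algebra_simps)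
  have "QEC ?P = s - 2"
  proof (rule QEC_eqI[OF sum])
    show "0 < vinner (pverts ?P) f f" unfolding N using s by (simp add: add_pos_nonneg)
    show "dist_form ?P f = (s - 2) * vinner (pverts ?P) f f"
      unfolding N four f by (simp add: power2_eq_square algebra_simps s(1) ss)
  next
    fix g :: "nat \<Rightarrow> real" assume g: "sum g (pverts ?P) = 0"
    define a b c where abc: "a = g 1" "b = g 1 + g 2" "c = - g 4"
    have vals: "g (Suc 0) = a" "g 2 = b - a" "g 3 = c - b" "g 4 = - c"
      using g by (simp_all add: V abc)
    have "(s - 2) * vinner (pverts ?P) g g - dist_form ?P g
        = 2 * (s - 1) * ((b + s * (a + c) / 2)\<^sup>2 + (a - c)\<^sup>2 / 2)"
      unfolding four V vals by (simp add: vinner_def vals power2_eq_square field_simps s(1) ss)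
    also have "\<dots> \<ge> 0" using s by simp
    finally show "dist_form ?P g \<le> (s - 2) * vinner (pverts ?P) g g" by simp
  qed
  then show ?thesis by (simp add: s_def)
qed

section \<open>Graphs below the path on four vertices\<close>

locale QEC_below_path4 =
  fixes G :: "'a pair_pre_digraph"
  assumes connected_graph: "connected_graph G"
    and QEC_less: "QEC G < sqrt 2 - 2"
begin

sublocale pair_graph G
  using connected_graph by (simp add: connected_graph_def)

abbreviation adj :: "'a \<Rightarrow> 'a \<Rightarrow> bool" where
  "adj x y \<equiv> (x, y) \<in> parcs G"

lemma adj_sym: "adj x y \<Longrightarrow> adj y x"
  by (rule arcs_symmetric)

lemma QEC_less_half: "QEC G < - 1 / 2"
proof -
  have "sqrt 2 < 3 / 2" by (rule real_less_lsqrt) (simp_all add: power2_eq_square)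
  then show ?thesis using QEC_less by simp
qed

text \<open>
  The test function is \<open>3\<close> at the centre and \<open>-1\<close> at the leaves, with quotient \<open>-6/12\<close>.
\<close>

lemma no_claw:
  assumes "adj v a" "adj v b" "adj v c" "distinct [a, b, c]"
  shows "adj a b \<or> adj a c \<or> adj b c"
proof (rule ccontr)
  assume non: "\<not> ?thesis"
  have d: "graph_dist G v a = 1" "graph_dist G v b = 1" "graph_dist G v c = 1"
    by (rule graph_dist_adjacent[OF pair_wf_digraph]; use assms no_loops' in blast)+
  have e: "graph_dist G a b = 2" "graph_dist G a c = 2" "graph_dist G b c = 2"
    by (rule graph_dist_2[OF pair_wf_digraph, of _ v]; use assms non adj_sym in auto)+
  have "distinct [v, a, b, c]" using assms no_loops' by auto
  then have "- 6 \<le> QEC G * 12"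
    using four_point_bound[OF pair_graph, of v a b c 3 "-1" "-1" "-1"] assms in_arcsD1 in_arcsD2
    by (simp add: d e)
  then show False using QEC_less_half by simp
qed

text \<open>
  The test function separates the two vertices of degree 3 from the other two, with quotient \<open>-2/4\<close>.
\<close>

lemma no_diamond:
  assumes "adj a b" "adj a c" "adj a d" "adj b c" "adj b d" "c \<noteq> d"
  shows "adj c d"
proof (rule ccontr)
  assume non: "\<not> ?thesis"
  have d: "graph_dist G a b = 1" "graph_dist G a c = 1" "graph_dist G a d = 1"
    "graph_dist G b c = 1" "graph_dist G b d = 1"
    by (rule graph_dist_adjacent[OF pair_wf_digraph]; use assms no_loops' in blast)+
  have e: "graph_dist G c d = 2"
    by (rule graph_dist_2[OF pair_wf_digraph, of _ a]; use assms non adj_sym in auto)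
  have "distinct [a, b, c, d]" using assms no_loops' by auto
  then have "- 2 \<le> QEC G * 4"
    using four_point_bound[OF pair_graph, of a b c d 1 1 "-1" "-1"] assms in_arcsD1 in_arcsD2
    by (simp add: d e)
  then show False using QEC_less_half by simp
qed

text \<open>
  The alternating function has quotient \<open>0\<close>.
\<close>

lemma no_C4:
  assumes "adj a b" "adj b c" "adj c d" "adj d a" "a \<noteq> c" "b \<noteq> d"
  shows "adj a c \<or> adj b d"
proof (rule ccontr)
  assume non: "\<not> ?thesis"
  have d: "graph_dist G a b = 1" "graph_dist G b c = 1" "graph_dist G c d = 1" "graph_dist G a d = 1"
    by (rule graph_dist_adjacent[OF pair_wf_digraph]; use assms no_loops' adj_sym in blast)+
  have "graph_dist G a c = 2" "graph_dist G b d = 2"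
    using graph_dist_2[OF pair_wf_digraph, of a b c] graph_dist_2[OF pair_wf_digraph, of b c d]
      assms non by auto
  note e = this
  have "distinct [a, b, c, d]" using assms no_loops' by auto
  then have "0 \<le> QEC G * 4"
    using four_point_bound[OF pair_graph, of a b c d 1 "-1" 1 "-1"] assms in_arcsD1 in_arcsD2
    by (simp add: d e)
  then show False using QEC_less_half by simp
qed

text \<open>
  The end points have distance 2 or 3 in \<open>G\<close>. The test function is the maximizer for \<open>P\<^sub>4\<close>; its values
  at the end points have opposite signs, so the quotient for distance 2 is even larger than that
  for distance 3, which is \<open>QEC P\<^sub>4\<close>.
\<close>

lemma no_P4:
  assumes "adj a b" "adj b c" "adj c d" "a \<noteq> c" "b \<noteq> d" "a \<noteq> d"
  shows "adj a c \<or> adj b d \<or> adj a d"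
proof (rule ccontr)
  assume non: "\<not> ?thesis"
  have d: "graph_dist G a b = 1" "graph_dist G b c = 1" "graph_dist G c d = 1"
    by (rule graph_dist_adjacent[OF pair_wf_digraph]; use assms no_loops' in blast)+
  have e: "graph_dist G a c = 2" "graph_dist G b d = 2"
    using graph_dist_2[OF pair_wf_digraph, of a b c] graph_dist_2[OF pair_wf_digraph, of b c d]
      assms non by auto
  have "graph_dist G a d \<le> 3"
    using graph_dist_3_le[OF pair_wf_digraph] assms by blast
  then have ad: "real (graph_dist G a d) \<le> 3" by simp
  define s :: real where "s = sqrt 2"
  have s: "s * s = 2" "1 < s" by (simp_all add: s_def)
  have ss: "s * (s * x) = 2 * x" for x using s(1) by (simp add: mult.assoc[symmetric])
  have "distinct [a, b, c, d]" using assms no_loops' by auto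
  then have "2 * (- (1 + s) + 2 * (1 + s) - real (graph_dist G a d) - (1 + s)\<^sup>2 + 2 * (1 + s) - (1 + s))
      \<le> QEC G * (2 + 2 * (1 + s)\<^sup>2)"
    using four_point_bound[OF pair_graph, of a b c d 1 "- (1 + s)" "1 + s" "- 1"] assms in_arcsD1 in_arcsD2
    by (simp add: d e power2_eq_square algebra_simps)
  moreover have "(s - 2) * (2 + 2 * (1 + s)\<^sup>2)
      = 2 * (- (1 + s) + 2 * (1 + s) - 3 - (1 + s)\<^sup>2 + 2 * (1 + s) - (1 + s))"
    by (simp add: power2_eq_square algebra_simps s(1) ss)
  ultimately have "(s - 2) * (2 + 2 * (1 + s)\<^sup>2) \<le> QEC G * (2 + 2 * (1 + s)\<^sup>2)"
    using ad by simp
  moreover have "0 < 2 + 2 * (1 + s)\<^sup>2" by (simp add: add_pos_nonneg)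
  ultimately have "s - 2 \<le> QEC G" by (simp only: mult_le_cancel_right_pos)
  then show False using QEC_less by (simp add: s_def)
qed

lemma connected_rtrancl:
  assumes "x \<in> pverts G" "y \<in> pverts G"
  shows "(x, y) \<in> (parcs G)\<^sup>*"
proof -
  have "Digraph_Component.connected (with_proj G)"
    using connected_graph by (simp add: connected_graph_def)
  then have "x \<rightarrow>\<^sup>*\<^bsub>with_proj (mk_symmetric (with_proj G))\<^esub> y"
    using assms by (auto simp: Digraph_Component.connected_def strongly_connected_def)
  then show ?thesis
    using reachable_mk_symmetric_eq[OF sym_arcs] reachable_conv by auto
qed

text \<open>
  Otherwise \<open>v, y\<close> and \<open>x, z\<close> would form a diamond.
\<close>

lemma adj_trans_off_centre:
  assumes "adj v x" "adj v y" "adj v z" "adj x y" "adj y z" "x \<noteq> z"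
  shows "adj x z"
  using no_diamond[of v y x z] assms adj_sym by blast

text \<open>
  Without an induced path on three vertices adjacency would be transitive, so that all vertices
  of the connected graph \<open>G\<close> would be adjacent.
\<close>

lemma induced_P3_exists:
  assumes "x \<in> pverts G" "y \<in> pverts G" "x \<noteq> y" "\<not> adj x y"
  shows "\<exists>a v c. adj v a \<and> adj v c \<and> a \<noteq> c \<and> \<not> adj a c"
proof (rule ccontr)
  assume "\<not> ?thesis"
  then have trans: "adj a c" if "adj a v" "adj v c" "a \<noteq> c" for a v c
    using that adj_sym by blast
  have "x = z \<or> adj x z" if "(x, z) \<in> (parcs G)\<^sup>*" for z
    using that by induction (use trans in blast)+
  then show False using connected_rtrancl assms by blast
qed

text \<open>
  By connectedness it suffices that \<open>v\<close> and its neighbours form a set closed under adjacency. If \<open>w\<close>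
  is adjacent to a neighbour \<open>u\<close> of \<open>v\<close> but not to \<open>v\<close>, then \<open>w\<close> is adjacent to neither \<open>a\<close> nor \<open>c\<close>, by the
  4-cycle or the 4-path through \<open>w, a, v, c\<close>. The 4-paths \<open>w - u - v - a\<close> and \<open>w - u - v - c\<close> then force
  \<open>u\<close> to be adjacent to \<open>a\<close> and \<open>c\<close>, and \<open>v, u, a, c\<close> form a diamond.
\<close>

lemma induced_P3_centre_universal:
  assumes "adj v a" "adj v c" "a \<noteq> c" "\<not> adj a c" and w: "w \<in> pverts G" "w \<noteq> v"
  shows "adj v w"
proof -
  have step: "w = v \<or> adj v w" if u: "adj v u" and uw: "adj u w" for u w
  proof (rule ccontr)
    assume w: "\<not> (w = v \<or> adj v w)"
    have "\<not> adj w a \<and> \<not> adj w c"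
    proof -
      have "\<not> (adj w a \<and> adj w c)"
        using no_C4[of w a v c] w assms adj_sym by blast
      moreover have "\<not> (adj w a \<and> \<not> adj w c)"
        using no_P4[of w a v c] w assms adj_sym by blast
      moreover have "\<not> (adj w c \<and> \<not> adj w a)"
        using no_P4[of w c v a] w assms adj_sym by blast
      ultimately show ?thesis by blast
    qed
    moreover from this have "u \<noteq> a" "u \<noteq> c" using uw adj_sym by blast+
    ultimately have "adj u a" "adj u c"
      using no_P4[of w u v a] no_P4[of w u v c] w u uw assms adj_sym by blast+
    then show False using no_diamond[of v u a c] u assms by blast
  qed
  have "(v, w) \<in> (parcs G)\<^sup>*" using connected_rtrancl assms(1) w in_arcsD1 by blast
  then have "w = v \<or> adj v w"
    by induction (use step in blast)+
  then show ?thesis using w by blast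
qed

text \<open>
  \<open>X\<close> and \<open>Y\<close> are the classes of \<open>a\<close> and \<open>c\<close> under adjacency among the neighbours of \<open>v\<close>. A vertex outside
  both would give a claw with centre \<open>v\<close> and leaves \<open>a\<close>, \<open>c\<close>.
\<close>

lemma clique_star_if_not_complete:
  assumes "x \<in> pverts G" "y \<in> pverts G" "x \<noteq> y" "\<not> adj x y"
  obtains v X Y where "clique_star G v X Y" "X \<noteq> {}" "Y \<noteq> {}"
proof -
  obtain a v c where P3: "adj v a" "adj v c" "a \<noteq> c" "\<not> adj a c"
    using induced_P3_exists[OF assms] by blast
  have univ: "adj v w" if "w \<in> pverts G" "w \<noteq> v" for w
    using induced_P3_centre_universal[OF P3 that] .
  define X where "X = {x \<in> pverts G. x \<noteq> v \<and> (x = a \<or> adj a x)}"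
  define Y where "Y = {x \<in> pverts G. x \<noteq> v \<and> (x = c \<or> adj c x)}"
  note trans = adj_trans_off_centre[of v]
  have in_V: "v \<in> pverts G" "a \<in> pverts G" "c \<in> pverts G" "a \<noteq> v" "c \<noteq> v"
    using P3 in_arcsD1 in_arcsD2 no_loops' by blast+
  have "X \<inter> Y = {}"
  proof -
    have False if "x \<in> X" "x \<in> Y" for x
      using that trans[of a x c] univ[of x] P3 adj_sym unfolding X_def Y_def by blast
    then show ?thesis by blast
  qed
  moreover have cover: "pverts G = insert v (X \<union> Y)"
  proof -
    have "w \<in> insert v (X \<union> Y)" if "w \<in> pverts G" for w
      using no_claw[of v a c w] P3 univ[OF that] that unfolding X_def Y_def by auto
    then show ?thesis using in_V unfolding X_def Y_def by blast
  qed
  moreover have "v \<notin> X \<union> Y" by (simp add: X_def Y_def)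
  moreover have "adj x y \<longleftrightarrow> x \<noteq> y \<and> ({x, y} \<subseteq> insert v X \<or> {x, y} \<subseteq> insert v Y)" for x y
  proof
    assume xy: "adj x y"
    then have V: "x \<in> pverts G" "y \<in> pverts G" "x \<noteq> y" using in_arcsD1 in_arcsD2 no_loops' by blast+
    show "x \<noteq> y \<and> ({x, y} \<subseteq> insert v X \<or> {x, y} \<subseteq> insert v Y)"
    proof (cases "x = v \<or> y = v")
      case True
      then show ?thesis using V cover by auto
    next
      case False
      then have "adj v x" "adj v y" using univ V by blast+
      then have "x \<in> X \<Longrightarrow> y \<in> X" "x \<in> Y \<Longrightarrow> y \<in> Y"
        using trans[of a x y] trans[of c x y] P3 xy V False unfolding X_def Y_def by blast+
      then show ?thesis using cover V False by auto
    qed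
  next
    assume xy: "x \<noteq> y \<and> ({x, y} \<subseteq> insert v X \<or> {x, y} \<subseteq> insert v Y)"
    then have V: "x \<in> pverts G" "y \<in> pverts G" using cover by auto
    show "adj x y"
    proof (cases "x = v \<or> y = v")
      case True
      then show ?thesis using univ V xy adj_sym by blast
    next
      case False
      then have "adj v x" "adj v y" using univ V by blast+
      then show ?thesis
        using trans[of x a y] trans[of x c y] P3 xy False adj_sym unfolding X_def Y_def by blast
    qed
  qed
  then have "parcs G = {(x, y). x \<noteq> y \<and> ({x, y} \<subseteq> insert v X \<or> {x, y} \<subseteq> insert v Y)}"
    by (intro set_eqI) (simp only: split_paired_all mem_Collect_eq case_prod_conv)
  ultimately have "clique_star G v X Y"
    unfolding clique_star_def by simp
  moreover have "a \<in> X" "c \<in> Y" using in_V by (auto simp: X_def Y_def)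
  ultimately show thesis using that by blast
qed

end

section \<open>Which stars lie below the path on four vertices\<close>

text \<open>
  With \<open>p = n - 1\<close> and \<open>q = m - 1\<close> this is the product \<open>(1 - 1/n) (1 - 1/m)\<close> that determines
  \<open>QEC (K\<^sub>n \<star> K\<^sub>m)\<close>.
\<close>

definition star_ratio :: "nat \<Rightarrow> nat \<Rightarrow> real" where
  "star_ratio p q = real p / (real p + 1) * (real q / (real q + 1))"

lemma star_ratio_alt: "star_ratio p q = real (p * q) / real (Suc p * Suc q)"
  by (simp add: star_ratio_def algebra_simps)

lemma star_ratio_nonneg: "0 \<le> star_ratio p q"
  by (simp add: star_ratio_def)

text \<open>
  Clearing denominators, \<open>2pq < (p + 1) (q + 1)\<close> means \<open>(p - 1) (q - 1) < 2\<close>.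
\<close>

lemma star_ratio_less_half_iff:
  assumes "1 \<le> p" "1 \<le> q"
  shows "star_ratio p q < 1 / 2 \<longleftrightarrow> p = 1 \<or> q = 1 \<or> p = 2 \<and> q = 2"
proof -
  have "star_ratio p q < 1 / 2 \<longleftrightarrow> 2 * real (p * q) < real (Suc p * Suc q)"
    unfolding star_ratio_alt by (subst pos_divide_less_eq) (simp_all add: mult.commute[of 2] del: of_nat_mult mult_Suc mult_Suc_right)
  also have "\<dots> \<longleftrightarrow> 2 * (p * q) < Suc p * Suc q" by linarith
  also have "\<dots> \<longleftrightarrow> p = 1 \<or> q = 1 \<or> p = 2 \<and> q = 2"
  proof (cases "p = 1 \<or> q = 1")
    case True
    then show ?thesis by auto
  next
    case False
    then obtain a b where "p = a + 2" "q = b + 2"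
      using assms by (metis add.commute le_Suc_ex one_add_one plus_1_eq_Suc le_neq_implies_less Suc_leI)
    then show ?thesis by (auto simp: algebra_simps)
  qed
  finally show ?thesis .
qed

lemma star_ratio_ge_quarter:
  assumes "1 \<le> p" "1 \<le> q"
  shows "1 / 4 \<le> star_ratio p q"
proof -
  have "1 / 2 \<le> real p / (real p + 1)" "1 / 2 \<le> real q / (real q + 1)"
    using assms by (simp_all add: field_simps)
  from mult_mono[OF this] show ?thesis by (simp add: star_ratio_def)
qed

lemma star_ratio_eq_quarter_iff:
  assumes "1 \<le> p" "1 \<le> q"
  shows "star_ratio p q = 1 / 4 \<longleftrightarrow> p = 1 \<and> q = 1"
proof
  assume eq: "star_ratio p q = 1 / 4"
  then have "p = 1 \<or> q = 1 \<or> p = 2 \<and> q = 2"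
    using star_ratio_less_half_iff[OF assms] by simp
  then show "p = 1 \<and> q = 1"
    using eq by (auto simp: star_ratio_def field_simps)
qed (simp add: star_ratio_def)

lemma QEC_clique_star_ratio:
  assumes "pair_graph G" "clique_star G v X Y" "1 \<le> card X" "1 \<le> card Y"
  shows "QEC G = - 1 / (1 + sqrt (star_ratio (card X) (card Y)))"
  unfolding star_ratio_def using assms
  by (intro QEC_clique_star) (auto simp: card_gt_0_iff Suc_le_eq)

text \<open>
  The function \<open>t \<mapsto> -1 / (1 + sqrt t)\<close> is strictly increasing, so values of \<open>QEC\<close> in this form
  are compared through \<open>t\<close>; the values \<open>1/4\<close> and \<open>1/2\<close> of \<open>t\<close> belong to \<open>P\<^sub>3\<close> and \<open>P\<^sub>4\<close>.
\<close>

lemma sqrt_fraction_less_iff: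
  assumes "0 \<le> t" "0 \<le> u"
  shows "- 1 / (1 + sqrt t) < - 1 / (1 + sqrt u) \<longleftrightarrow> t < u"
proof -
  have "0 < 1 + sqrt t" "0 < 1 + sqrt u" using assms by (simp_all add: add_pos_nonneg)
  then show ?thesis by (simp add: field_simps)
qed

lemma sqrt_fraction_half: "sqrt 2 - 2 = - 1 / (1 + sqrt (1 / 2))"
proof -
  have "(sqrt 2 - 2) * (1 + sqrt (1 / 2)) = - 1"
    by (simp add: real_sqrt_divide field_simps)
  moreover have "0 < 1 + sqrt (1 / 2)" by (simp add: add_pos_nonneg)
  ultimately show ?thesis by (subst nonzero_eq_divide_eq) auto
qed

lemma pair_graph_star_complete: "pair_graph (star_complete (Suc p) (Suc q))"
proof -
  let ?S = "star_complete (Suc p) (Suc q)"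
  have "finite (parcs ?S)"
    by (rule finite_subset[of _ "pverts ?S \<times> pverts ?S"]) (auto simp: star_complete_def)
  then show ?thesis
    by unfold_locales (auto simp: star_complete_def symmetric_def sym_def)
qed

lemma QEC_star_complete:
  assumes "1 \<le> p" "1 \<le> q"
  shows "QEC (star_complete (Suc p) (Suc q)) = - 1 / (1 + sqrt (star_ratio p q))"
  using QEC_clique_star_ratio[OF pair_graph_star_complete clique_star_star_complete, of p q] assms
  by simp

lemma QEC_path_3: "QEC (graph_path 3) = - 1 / (1 + sqrt (1 / 4))"
  using QEC_star_complete[of 1 1] by (simp add: graph_path_3 star_ratio_def numeral_2_eq_2)

lemma QEC_graph_iso_star_complete:
  assumes "pair_graph G" "graph_iso G (star_complete (Suc p) (Suc q))" "1 \<le> p" "1 \<le> q"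
  shows "QEC G = - 1 / (1 + sqrt (star_ratio p q))"
  using assms QEC_clique_star_ratio graph_iso_star_complete_iff by metis

text \<open>
  The lower bound excludes the complete graphs.
\<close>

lemma QEC_between_P3_P4_imp_star:
  assumes G: "connected_graph G" and ge: "QEC (graph_path 3) \<le> QEC G" and less: "QEC G < QEC (graph_path 4)"
  obtains v X Y where "clique_star G v X Y" "1 \<le> card X" "1 \<le> card Y"
    "star_ratio (card X) (card Y) < 1 / 2" "QEC G = - 1 / (1 + sqrt (star_ratio (card X) (card Y)))"
proof -
  interpret QEC_below_path4 G
    using G less by unfold_locales (simp_all add: QEC_path_4)
  have "\<exists>x\<in>pverts G. \<exists>y\<in>pverts G. x \<noteq> y \<and> (x, y) \<notin> parcs G"
  proof (rule ccontr)
    assume "\<not> ?thesis"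
    moreover have "2 \<le> card (pverts G)" using G by (simp add: connected_graph_def)
    ultimately have "QEC G = - 1" by (intro QEC_complete) auto
    then show False using ge by (simp add: QEC_path_3 real_sqrt_divide)
  qed
  then obtain v X Y where star: "clique_star G v X Y" "X \<noteq> {}" "Y \<noteq> {}"
    using clique_star_if_not_complete by metis
  then have card: "1 \<le> card X" "1 \<le> card Y"
    using pair_finite_verts by (auto simp: clique_star_def Suc_le_eq card_gt_0_iff)
  note eq = QEC_clique_star_ratio[OF pair_graph star(1) card]
  have "star_ratio (card X) (card Y) < 1 / 2"
    using QEC_less sqrt_fraction_less_iff[OF star_ratio_nonneg, of "1 / 2" "card X" "card Y"]
    unfolding eq sqrt_fraction_half by simp
  then show thesis using that star(1) card eq by blast
qed

theorem theorem4p11: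
  "(\<forall>G :: 'a pair_pre_digraph. connected_graph G \<longrightarrow>
      (QEC (graph_path 3) \<le> QEC G \<and> QEC G < QEC (graph_path 4) \<longleftrightarrow>
        (\<exists>n\<ge>2. graph_iso G (star_complete n 2)) \<or> graph_iso G (star_complete 3 3))) \<and>
   (\<forall>n\<ge>2. QEC (star_complete n 2) = - 2 / (2 + sqrt (2 * (1 - 1 / real n)))) \<and>
   QEC (star_complete 3 3) = - 3 / 5 \<and>
   (\<forall>G :: 'a pair_pre_digraph. connected_graph G \<longrightarrow>
      (QEC G = QEC (graph_path 3) \<longleftrightarrow> graph_iso G (graph_path 3))) \<and>
   graph_iso (graph_path 3) (star_complete 2 2)"
proof (intro conjI allI impI)
  fix G :: "'a pair_pre_digraph"
  assume G: "connected_graph G"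
  then have pg: "pair_graph G" by (simp add: connected_graph_def)
  have bounds: "QEC (graph_path 3) \<le> QEC G \<and> QEC G < QEC (graph_path 4)"
    if iso: "graph_iso G (star_complete (Suc p) (Suc q))" and pq: "1 \<le> p" "1 \<le> q" "star_ratio p q < 1 / 2" for p q
  proof -
    have "\<not> star_ratio p q < 1 / 4" using star_ratio_ge_quarter[OF pq(1,2)] by simp
    then have "\<not> QEC G < QEC (graph_path 3)"
      unfolding QEC_path_3 QEC_graph_iso_star_complete[OF pg iso pq(1,2)]
      by (subst sqrt_fraction_less_iff) (simp_all add: star_ratio_nonneg)
    moreover have "QEC G < QEC (graph_path 4)"
      unfolding QEC_path_4 sqrt_fraction_half QEC_graph_iso_star_complete[OF pg iso pq(1,2)]
      using pq(3) by (subst sqrt_fraction_less_iff) (simp_all add: star_ratio_nonneg)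
    ultimately show ?thesis by simp
  qed
  show "QEC (graph_path 3) \<le> QEC G \<and> QEC G < QEC (graph_path 4) \<longleftrightarrow>
      (\<exists>n\<ge>2. graph_iso G (star_complete n 2)) \<or> graph_iso G (star_complete 3 3)"
  proof
    assume "QEC (graph_path 3) \<le> QEC G \<and> QEC G < QEC (graph_path 4)"
    then obtain v X Y where star: "clique_star G v X Y"
      and card: "1 \<le> card X" "1 \<le> card Y" "star_ratio (card X) (card Y) < 1 / 2"
      using QEC_between_P3_P4_imp_star[OF G] by metis
    consider "card Y = 1" | "card X = 1" | "card X = 2" "card Y = 2"
      using card star_ratio_less_half_iff[OF card(1,2)] by blast
    then show "(\<exists>n\<ge>2. graph_iso G (star_complete n 2)) \<or> graph_iso G (star_complete 3 3)"
    proof cases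
      case 1
      then have "graph_iso G (star_complete (Suc (card X)) (Suc 1))"
        using graph_iso_star_complete_iff[OF pg] star by blast
      then have "\<exists>n\<ge>2. graph_iso G (star_complete n 2)"
        using card(1) by (intro exI[of _ "Suc (card X)"]) (simp add: numeral_2_eq_2)
      then show ?thesis ..
    next
      case 2
      then have "graph_iso G (star_complete (Suc (card Y)) (Suc 1))"
        using graph_iso_star_complete_iff[OF pg] star[unfolded clique_star_swap[of G v X]] by blast
      then have "\<exists>n\<ge>2. graph_iso G (star_complete n 2)"
        using card(2) by (intro exI[of _ "Suc (card Y)"]) (simp add: numeral_2_eq_2)
      then show ?thesis ..
    next
      case 3
      then have "graph_iso G (star_complete (Suc 2) (Suc 2))"
        using graph_iso_star_complete_iff[OF pg] star by blast
      then show ?thesis by simp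
    qed
  next
    assume "(\<exists>n\<ge>2. graph_iso G (star_complete n 2)) \<or> graph_iso G (star_complete 3 3)"
    then show "QEC (graph_path 3) \<le> QEC G \<and> QEC G < QEC (graph_path 4)"
    proof (elim disjE exE conjE)
      fix n :: nat assume n: "2 \<le> n" "graph_iso G (star_complete n 2)"
      then obtain p where "n = Suc p" "1 \<le> p" by (cases n) auto
      then show ?thesis
        using n bounds[of p 1] star_ratio_less_half_iff[of p 1] by (simp add: numeral_2_eq_2)
    next
      assume "graph_iso G (star_complete 3 3)"
      then show ?thesis
        using bounds[of 2 2] star_ratio_less_half_iff[of 2 2] by simp
    qed
  qed
next
  fix n :: nat assume n: "2 \<le> n"
  then obtain p where p: "n = Suc p" "1 \<le> p" by (cases n) auto
  have "star_ratio p 1 = 2 * (1 - 1 / real n) / 2\<^sup>2"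
    using p by (simp add: star_ratio_def field_simps)
  then have root: "sqrt (star_ratio p 1) = sqrt (2 * (1 - 1 / real n)) / 2"
    by (simp only: real_sqrt_divide real_sqrt_abs)
  have "QEC (star_complete n 2) = - 1 / (1 + sqrt (star_ratio p 1))"
    using QEC_star_complete[of p 1] p by (simp add: numeral_2_eq_2)
  also have "\<dots> = - 2 / (2 + sqrt (2 * (1 - 1 / real n)))"
  proof -
    have "0 \<le> sqrt (2 * (1 - 1 / real n))"
      by (intro real_sqrt_ge_zero mult_nonneg_nonneg) (use n in simp_all)
    then show ?thesis unfolding root by (simp add: divide_simps)
  qed
  finally show "QEC (star_complete n 2) = - 2 / (2 + sqrt (2 * (1 - 1 / real n)))" .
next
  show "QEC (star_complete 3 3) = - 3 / 5"
  proof -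
    have "star_ratio 2 2 = (2 / 3)\<^sup>2" by (simp add: star_ratio_def power2_eq_square)
    then have root: "sqrt (star_ratio 2 2) = 2 / 3" by simp
    show ?thesis using QEC_star_complete[of 2 2] unfolding root by simp
  qed
next
  fix G :: "'a pair_pre_digraph"
  assume G: "connected_graph G"
  then have pg: "pair_graph G" by (simp add: connected_graph_def)
  have P3: "graph_path 3 = star_complete (Suc 1) (Suc 1)"
    by (simp add: graph_path_3 numeral_2_eq_2)
  show "QEC G = QEC (graph_path 3) \<longleftrightarrow> graph_iso G (graph_path 3)"
  proof
    assume eq: "QEC G = QEC (graph_path 3)"
    have "QEC (graph_path 3) < QEC (graph_path 4)"
      unfolding QEC_path_3 QEC_path_4 sqrt_fraction_half by (subst sqrt_fraction_less_iff) simp_all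
    then obtain v X Y where star: "clique_star G v X Y" and card: "1 \<le> card X" "1 \<le> card Y"
      and "QEC G = - 1 / (1 + sqrt (star_ratio (card X) (card Y)))"
      using QEC_between_P3_P4_imp_star[OF G] eq by (metis order_refl)
    then have "star_ratio (card X) (card Y) = 1 / 4"
      using eq sqrt_fraction_less_iff[of "star_ratio (card X) (card Y)" "1 / 4"]
        sqrt_fraction_less_iff[of "1 / 4" "star_ratio (card X) (card Y)"]
      unfolding QEC_path_3 by (simp add: star_ratio_nonneg)
    then have "card X = 1" "card Y = 1" using star_ratio_eq_quarter_iff[OF card] by auto
    then show "graph_iso G (graph_path 3)"
      unfolding P3 using graph_iso_star_complete_iff[OF pg] star by blast
  next
    assume "graph_iso G (graph_path 3)"
    then show "QEC G = QEC (graph_path 3)"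
      unfolding QEC_path_3 using QEC_graph_iso_star_complete[OF pg, of 1 1] star_ratio_eq_quarter_iff[of 1 1]
      by (simp add: P3)
  qed
next
  show "graph_iso (graph_path 3) (star_complete 2 2)"
    using clique_star_iso[OF clique_star_star_complete[of 1 1] clique_star_star_complete[of 1 1]]
    by (simp add: graph_path_3 numeral_2_eq_2)
qed

end
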